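(* Let $T=\{1,\dots,m\}$, let $a_t\in\mathbb{R}^n$ ($t\in T$) and $c_1,\dots,c_q\in\mathbb{R}^n$ be fixed, and for $b=(b_t)_{t\in T}\in\mathbb{R}^T$ let $\mathcal{F}(b):=\{x\in\mathbb{R}^n:\langle a_t,x\rangle\le b_t,\ t\in T\}$ and $\mathcal{E}_{\mathcal{F}}(b):=\mathcal{F}(b)+\{c_1,\dots,c_q\}^\circ$. For any $b\in\mathbb{R}^T$ we have $$\mathcal{E}_{\mathcal{F}}(b)=\bigcap_{c\in\mathrm{conv}\{c_1,\dots,c_q\}}\big(\mathcal{F}(b)+\{c\}^\circ\big).$$
   Context: For $\Omega\subset\mathbb{R}^n$, $\Omega^\circ:=\{y\in\mathbb{R}^n:\langle y,x\rangle\ge0\ \text{for all }x\in\Omega\}$ is the positive polar cone; $\mathrm{conv}$ denotes the convex hull; sums of sets are Minkowski sums. *)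

theory Defs
  imports "HOL-Analysis.Analysis"
begin

definition positive_polar :: "(real ^ 'n) set \<Rightarrow> (real ^ 'n) set" where
  "positive_polar \<Omega> = {y. \<forall>x\<in>\<Omega>. 0 \<le> y \<bullet> x}"

(* The index set is T = {1..m}: only the values a t and b t with 1 <= t <= m matter,
   so b represents an arbitrary element of R^T. *)
definition feasible_set :: "nat \<Rightarrow> (nat \<Rightarrow> real ^ 'n) \<Rightarrow> (nat \<Rightarrow> real) \<Rightarrow> (real ^ 'n) set" where
  "feasible_set m a b = {x. \<forall>t\<in>{1..m}. a t \<bullet> x \<le> b t}"

(* The sum of sets is the Minkowski sum of HOL-Library.Set_Algebras. *)
definition epi_feasible_set ::
    "nat \<Rightarrow> (nat \<Rightarrow> real ^ 'n) \<Rightarrow> nat \<Rightarrow> (nat \<Rightarrow> real ^ 'n) \<Rightarrow> (nat \<Rightarrow> real) \<Rightarrow> (real ^ 'n) set" where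
  "epi_feasible_set m a q c b = feasible_set m a b + positive_polar (c ` {1..q})"

end

theory Submission imports Defs
begin

text \<open>
  A point \<open>x0\<close> lies in \<open>F + \<Omega>\<degree>\<close> exactly when some \<open>x \<in> F\<close> satisfies
  \<open>d \<bullet> x \<le> d \<bullet> x0\<close> for all \<open>d \<in> \<Omega>\<close>.  So the theorem is an exchange of quantifiers: if every
  convex combination \<open>d\<close> of the \<open>c i\<close> admits a feasible \<open>x\<close>, which may depend on \<open>d\<close>, then one
  feasible \<open>x\<close> serves all the \<open>c i\<close> at once.

  The exchange is Farkas' lemma.  The common \<open>x\<close> is a solution of the finite linear system
  \<open>a t \<bullet> x \<le> b t\<close>, \<open>c i \<bullet> x \<le> c i \<bullet> x0\<close>.  If this system is inconsistent, nonnegative multipliers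
  combine it into \<open>0 \<le> -1\<close>.  The multipliers of the \<open>c i\<close> are, up to a factor \<open>r \<ge> 0\<close>, the weights
  of a convex combination \<open>d\<close>, so the second half of the system contributes the inequality
  \<open>r (d \<bullet> x) \<le> r (d \<bullet> x0)\<close>.  A feasible \<open>x\<close> that belongs to this single \<open>d\<close> therefore satisfies
  the combined inequality, which is absurd.  The multipliers exist because both \<open>F\<close> and the set
  of the \<open>c i\<close> are given by finite data, which makes the cone of derivable inequalities closed.
\<close>

text \<open>
  Farkas' lemma for inhomogeneous systems.  A pair \<open>(u, \<beta>)\<close> encodes the inequality
  \<open>u \<bullet> x \<le> \<beta>\<close>; the convex cone generated by a set of pairs then consists of the inequalities
  derivable with nonnegative multipliers, and \<open>(0, -1)\<close> encodes the contradiction \<open>0 \<le> -1\<close>.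
  The cone is closed because it is finitely generated, so \<open>(0, -1)\<close> can be strictly separated from it,
  and a separating hyperplane, scaled so that its last coordinate is \<open>-1\<close>, is a solution.
\<close>

lemma farkas_consistent:
  fixes S :: "('a::euclidean_space \<times> real) set"
  assumes fin: "finite S" and nc: "(0, -1) \<notin> convex_cone hull S"
  shows "\<exists>x. \<forall>(u, \<beta>)\<in>S. u \<bullet> x \<le> \<beta>"
proof -
  let ?K = "convex_cone hull S"
  have "closed ?K"
    using fin by (simp add: polyhedron_convex_cone_hull polyhedron_imp_closed)
  then obtain w \<gamma> where less: "w \<bullet> (0, -1) < \<gamma>" and gt: "\<And>z. z \<in> ?K \<Longrightarrow> \<gamma> < w \<bullet> z"
    using separating_hyperplane_closed_point[OF convex_convex_cone_hull _ nc] by blast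
  obtain y s where w: "w = (y, s)" by (cases w)
  have "\<gamma> < 0"
    using gt[OF convex_cone_hull_contains_0] by simp
  then have "s > 0"
    using less by (simp add: w)
  have nonneg: "0 \<le> w \<bullet> z" if "z \<in> S" for z
  proof (rule ccontr)
    assume neg: "\<not> 0 \<le> w \<bullet> z"
    \<comment> \<open>The multiple of \<open>z\<close> on which \<open>w\<close> takes the value \<open>\<gamma>\<close> lies in the cone.\<close>
    have "(\<gamma> / (w \<bullet> z)) *\<^sub>R z \<in> ?K"
      using that neg \<open>\<gamma> < 0\<close> by (intro convex_cone_hull_mul hull_inc) (auto simp: divide_nonpos_neg)
    from gt[OF this] neg show False by simp
  qed
  have "u \<bullet> (- (1 / s) *\<^sub>R y) \<le> \<beta>" if "(u, \<beta>) \<in> S" for u \<beta>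
  proof -
    have "0 \<le> u \<bullet> y + s * \<beta>"
      using nonneg[OF that] by (simp add: w inner_commute mult.commute)
    then show ?thesis
      using \<open>s > 0\<close> by (simp add: field_simps inner_commute)
  qed
  then show ?thesis by blast
qed

lemma convex_cone_valid_inequalities:
  "convex_cone {(u :: 'a::real_inner, \<beta> :: real). u \<bullet> x \<le> \<beta>}"
  by (auto simp: convex_cone_iff zero_prod_def inner_left_distrib mult_left_mono intro: add_mono)

lemma mem_sum_positive_polar_iff:
  "x0 \<in> F + positive_polar \<Omega> \<longleftrightarrow> (\<exists>x\<in>F. \<forall>d\<in>\<Omega>. d \<bullet> x \<le> d \<bullet> x0)"
proof
  assume "x0 \<in> F + positive_polar \<Omega>"
  then obtain x y where "x \<in> F" "y \<in> positive_polar \<Omega>" "x0 = x + y"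
    by (rule set_plus_elim)
  then show "\<exists>x\<in>F. \<forall>d\<in>\<Omega>. d \<bullet> x \<le> d \<bullet> x0"
    by (auto simp: positive_polar_def inner_right_distrib inner_commute intro!: bexI[of _ x])
next
  assume "\<exists>x\<in>F. \<forall>d\<in>\<Omega>. d \<bullet> x \<le> d \<bullet> x0"
  then obtain x where "x \<in> F" "\<forall>d\<in>\<Omega>. d \<bullet> x \<le> d \<bullet> x0" by blast
  then have "x0 - x \<in> positive_polar \<Omega>"
    by (simp add: positive_polar_def inner_diff_right inner_commute[of "x0 - x"])
  with \<open>x \<in> F\<close> have "x + (x0 - x) \<in> F + positive_polar \<Omega>" by (rule set_plus_intro)
  then show "x0 \<in> F + positive_polar \<Omega>" by simp
qed

text \<open>
  The exchange of quantifiers: a certificate of inconsistency for the joint system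
  involves only one direction of \<open>convex hull C\<close>, so it is refuted by the feasible point
  of that direction.
\<close>

lemma uniform_feasible_point:
  fixes a :: "'i \<Rightarrow> 'a::euclidean_space" and C :: "'a set"
  assumes "finite T" "finite C" "C \<noteq> {}"
    and each: "\<And>d. d \<in> convex hull C \<Longrightarrow> \<exists>x. (\<forall>t\<in>T. a t \<bullet> x \<le> b t) \<and> d \<bullet> x \<le> d \<bullet> x0"
  shows "\<exists>x. (\<forall>t\<in>T. a t \<bullet> x \<le> b t) \<and> (\<forall>d\<in>C. d \<bullet> x \<le> d \<bullet> x0)"
proof -
  define A where "A = (\<lambda>t. (a t, b t)) ` T"
  define g where "g v = (v, v \<bullet> x0)" for v
  have "linear g"
    by (rule linearI) (auto simp: g_def inner_left_distrib)
  have "(0, -1) \<notin> convex_cone hull (A \<union> g ` C)"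
  proof
    assume "(0, -1) \<in> convex_cone hull (A \<union> g ` C)"
    then obtain p v where p: "p \<in> convex_cone hull A" and v: "v \<in> convex_cone hull C"
      and sum: "(0, -1) = p + g v"
      unfolding convex_cone_hull_Un convex_cone_hull_linear_image[OF \<open>linear g\<close>] by blast
    from v obtain r d where r: "0 \<le> r" and d: "d \<in> convex hull C" and vr: "v = r *\<^sub>R d"
      unfolding convex_cone_hull_separate_nonempty[OF \<open>C \<noteq> {}\<close>] conic_hull_explicit by blast
    obtain x where feas: "\<forall>t\<in>T. a t \<bullet> x \<le> b t" and dx: "d \<bullet> x \<le> d \<bullet> x0"
      using each[OF d] by blast
    have "convex_cone hull A \<subseteq> {(u, \<beta>). u \<bullet> x \<le> \<beta>}"
      by (rule hull_minimal) (use feas convex_cone_valid_inequalities in \<open>auto simp: A_def\<close>)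
    with p have px: "fst p \<bullet> x \<le> snd p" by auto
    have "v \<bullet> x \<le> v \<bullet> x0"
      using r dx by (simp add: vr mult_left_mono)
    moreover have "fst p = - v" "snd p = - 1 - v \<bullet> x0"
      using sum by (auto simp: g_def prod_eq_iff eq_neg_iff_add_eq_0)
    ultimately show False
      using px by simp
  qed
  then obtain x where "\<forall>(u, \<beta>)\<in>A \<union> g ` C. u \<bullet> x \<le> \<beta>"
    using farkas_consistent[of "A \<union> g ` C"] assms(1,2) by (auto simp: A_def)
  then show ?thesis
    by (auto simp: A_def g_def)
qed

theorem theorem4:
  fixes m q :: nat
    and a c :: "nat \<Rightarrow> real ^ 'n"
    and b :: "nat \<Rightarrow> real"
  assumes "q \<ge> 1"
  shows "epi_feasible_set m a q c b =
    (\<Inter>d\<in>convex hull (c ` {1..q}). feasible_set m a b + positive_polar {d})"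
proof (rule set_eqI)
  fix x0
  let ?C = "c ` {1..q}"
  have "(\<exists>x\<in>feasible_set m a b. \<forall>d\<in>?C. d \<bullet> x \<le> d \<bullet> x0) \<longleftrightarrow>
    (\<forall>d\<in>convex hull ?C. \<exists>x\<in>feasible_set m a b. d \<bullet> x \<le> d \<bullet> x0)" (is "?L \<longleftrightarrow> ?R")
  proof
    assume ?L
    then obtain x where x: "x \<in> feasible_set m a b" and le: "\<forall>d\<in>?C. d \<bullet> x \<le> d \<bullet> x0" by blast
    \<comment> \<open>The directions \<open>d\<close> for which \<open>x\<close> works form a half-space.\<close>
    have "convex hull ?C \<subseteq> {d. (x - x0) \<bullet> d \<le> 0}"
      using le by (intro hull_minimal convex_halfspace_le)
        (auto simp: inner_diff_left inner_commute[of _ "c _"])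
    then have "d \<bullet> x \<le> d \<bullet> x0" if "d \<in> convex hull ?C" for d
      using that by (auto simp: inner_diff_left inner_commute[of d])
    with x show ?R by blast
  next
    assume ?R
    then show ?L
      using uniform_feasible_point[of "{1..m}" ?C a b x0] assms
      by (auto simp: feasible_set_def Bex_def)
  qed
  then show "x0 \<in> epi_feasible_set m a q c b \<longleftrightarrow>
      x0 \<in> (\<Inter>d\<in>convex hull ?C. feasible_set m a b + positive_polar {d})"
    by (simp add: epi_feasible_set_def mem_sum_positive_polar_iff)
qed

end
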